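(* (SMDCT VIII) Let $n,N$ be positive integers and $\rho=\left(\frac12,\dots,\frac12\right)\in\mathbb{R}^n$. For all $k,k'\in D_N^+$, $$\sum_{s\in F_N^{\mathrm{VIII},+}}H_s^{-1}\cos_{k+\rho}^+(s)\cos_{k'+\rho}^+(s)=H_k\left(\frac{2N+1}{4}\right)^n\delta_{kk'}.$$ Consequently any function $f:F_N^{\mathrm{VIII},+}\to\mathbb{R}$ can be expanded, for all $s\in F_N^{\mathrm{VIII},+}$, as $$f(s)=\sum_{k\in D_N^+}A_k\cos^+_{k+\rho}(s)\quad\text{with}\quad A_k=\frac{1}{H_k}\left(\frac{4}{2N+1}\right)^n\sum_{s\in F_N^{\mathrm{VIII},+}}H_s^{-1}f(s)\cos_{k+\rho}^+(s).$$
   Context: For $\lambda,x\in\mathbb{R}^n$, the symmetric cosine function is $\cos^+_\lambda(x)=\sum_{\sigma\in S_n}\prod_{i=1}^n\cos(\pi\lambda_{\sigma(i)}x_i)$. For $y\in\mathbb{R}^n$, $H_y=\#\{\sigma\in S_n : \sigma(y)=y\}$ is the order of the stabilizer of $y$, where $\sigma(y)=(y_{\sigma(1)},\dots,y_{\sigma(n)})$. Let $D_N^+=\{(k_1,\dots,k_n)\in\mathbb{Z}^n : N-1\ge k_1\ge k_2\ge\dots\ge k_n\ge 0\}$. The grid is $F_N^{\mathrm{VIII},+}=\left\{\left(\frac{2(r_1+\frac12)}{2N+1},\dots,\frac{2(r_n+\frac12)}{2N+1}\right) : (r_1,\dots,r_n)\in D_N^+\right\}$. *)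

theory Defs
  imports Complex_Main "HOL-Library.FuncSet" "HOL-Combinatorics.Permutations"
begin

text \<open>
  A vector in \<open>\<real>\<^sup>n\<close> or \<open>\<int>\<^sup>n\<close> is a function on \<open>nat\<close> that is extensional on \<open>{1..n}\<close>, i.e.
  undefined outside \<open>{1..n}\<close>. Hence equality of vectors is equality of functions, and the index
  sets of the sums below are finite.
\<close>

definition cos_plus :: "nat \<Rightarrow> (nat \<Rightarrow> real) \<Rightarrow> (nat \<Rightarrow> real) \<Rightarrow> real" where
  "cos_plus n l x = (\<Sum>\<sigma> | \<sigma> permutes {1..n}. \<Prod>i=1..n. cos (pi * l (\<sigma> i) * x i))"

definition perm_act :: "nat \<Rightarrow> (nat \<Rightarrow> nat) \<Rightarrow> (nat \<Rightarrow> 'a) \<Rightarrow> (nat \<Rightarrow> 'a)" where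
  "perm_act n \<sigma> y = (\<lambda>i\<in>{1..n}. y (\<sigma> i))"

definition stab_order :: "nat \<Rightarrow> (nat \<Rightarrow> 'a) \<Rightarrow> nat" where
  "stab_order n y = card {\<sigma>. \<sigma> permutes {1..n} \<and> perm_act n \<sigma> y = y}"

definition D_plus :: "nat \<Rightarrow> nat \<Rightarrow> (nat \<Rightarrow> int) set" where
  "D_plus n N = {k \<in> extensional {1..n}.
     k 1 \<le> int N - 1 \<and> (\<forall>i\<in>{1..<n}. k (Suc i) \<le> k i) \<and> 0 \<le> k n}"

definition F_VIII_plus :: "nat \<Rightarrow> nat \<Rightarrow> (nat \<Rightarrow> real) set" where
  "F_VIII_plus n N =
     (\<lambda>r. \<lambda>i\<in>{1..n}. 2 * (real_of_int (r i) + 1/2) / (2 * real N + 1)) ` D_plus n N"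

definition rho :: "nat \<Rightarrow> (nat \<Rightarrow> real)" where
  "rho n = (\<lambda>i\<in>{1..n}. 1/2)"

definition shift_rho :: "nat \<Rightarrow> (nat \<Rightarrow> int) \<Rightarrow> (nat \<Rightarrow> real)" where
  "shift_rho n k = (\<lambda>i\<in>{1..n}. real_of_int (k i) + rho n i)"

definition coeff_VIII_plus ::
    "nat \<Rightarrow> nat \<Rightarrow> ((nat \<Rightarrow> real) \<Rightarrow> real) \<Rightarrow> (nat \<Rightarrow> int) \<Rightarrow> real" where
  "coeff_VIII_plus n N f k =
     1 / real (stab_order n k) * (4 / (2 * real N + 1)) ^ n *
     (\<Sum>s\<in>F_VIII_plus n N.
        inverse (real (stab_order n s)) * f s * cos_plus n (shift_rho n k) s)"

lemma D_plus_antimono: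
  assumes "k \<in> D_plus n N" "1 \<le> i" "i \<le> j" "j \<le> n"
  shows "k j \<le> k i"
  using assms(3,4)
proof (induction j rule: dec_induct)
  case (step j)
  then have "k (Suc j) \<le> k j" using assms(1,2) by (auto simp: D_plus_def)
  with step show ?case by simp
qed simp

lemma finite_D_plus:
  assumes "n \<ge> 1"
  shows "finite (D_plus n N)"
proof (rule finite_subset)
  show "D_plus n N \<subseteq> {1..n} \<rightarrow>\<^sub>E {0..int N - 1}"
  proof
    fix k assume k: "k \<in> D_plus n N"
    have "0 \<le> k i \<and> k i \<le> int N - 1" if "i \<in> {1..n}" for i
      using D_plus_antimono[OF k, of 1 i] D_plus_antimono[OF k, of i n] that k
      by (auto simp: D_plus_def)
    with k show "k \<in> {1..n} \<rightarrow>\<^sub>E {0..int N - 1}" by (auto simp: PiE_def D_plus_def)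
  qed
qed (auto intro: finite_PiE)

lemma finite_F_VIII_plus: "n \<ge> 1 \<Longrightarrow> finite (F_VIII_plus n N)"
  by (simp add: F_VIII_plus_def finite_D_plus)

end

theory Submission
  imports Defs
begin

text \<open>
  At the points of the grid the function \<open>cos_plus\<close> is the symmetrization of the kernel
  \<open>\<kappa>(j, r) = cos (\<pi> (2j+1) (2r+1) / (2 (2N+1)))\<close>, whose \<open>N \<times> N\<close> matrix has orthogonal rows of
  squared norm \<open>(2N+1)/4\<close> (\<open>cos_kernel_orthogonal\<close>). The multivariate statement follows formally
  from this, for any kernel with orthogonal rows:

  Summing a product of two symmetrized kernels over the whole cube \<open>{0..<N}\<^sup>n\<close> factorizes into
  one-dimensional sums and so counts the pairs \<open>(\<sigma>, \<tau>)\<close> of permutations with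
  \<open>k \<circ> \<sigma> = k' \<circ> \<tau>\<close>. The weakly decreasing vectors \<open>D_plus n N\<close> form a fundamental domain for
  the action of \<open>S\<^sub>n\<close> on the cube, so there are \<open>n! H\<^sub>k\<close> such pairs if \<open>k = k'\<close> and none
  otherwise. For the same reason the weights \<open>1 / H\<^sub>r\<close> turn a sum over \<open>D_plus n N\<close> of a symmetric
  function into \<open>1 / n!\<close> times its sum over the cube (\<open>sum_cube_eq_sum_D_plus\<close>), and the factor
  \<open>n!\<close> cancels.

  The expansion formula needs completeness rather than orthogonality, but \<open>\<kappa>\<close> is symmetric in
  its two arguments. Hence orthogonality of the rows is also orthogonality of the columns, and
  exchanging the two sums in the expansion leaves only the term \<open>f s\<close>.
\<close>


section \<open>The action of permutations on vectors\<close>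

lemma perm_act_eq_iff: "perm_act n \<sigma> y = perm_act n \<tau> z \<longleftrightarrow> (\<forall>i\<in>{1..n}. y (\<sigma> i) = z (\<tau> i))"
  unfolding perm_act_def restrict_def fun_eq_iff by auto

lemma perm_act_eq_self_iff:
  assumes "y \<in> extensional {1..n}"
  shows "perm_act n \<sigma> y = y \<longleftrightarrow> (\<forall>i\<in>{1..n}. y (\<sigma> i) = y i)"
  using assms unfolding perm_act_def restrict_def fun_eq_iff extensional_def by auto

lemma stab_order_pos:
  assumes "y \<in> extensional {1..n}"
  shows "stab_order n y > 0"
proof -
  have "id \<in> {\<sigma>. \<sigma> permutes {1..n} \<and> perm_act n \<sigma> y = y}"
    using assms by (auto simp: perm_act_eq_self_iff permutes_id)
  moreover have "finite {\<sigma>. \<sigma> permutes {1..n} \<and> perm_act n \<sigma> y = y}"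
    by (rule finite_subset[OF _ finite_permutations[of "{1..n}"]]) auto
  ultimately show ?thesis
    unfolding stab_order_def card_gt_0_iff by blast
qed

text \<open>
  The permutations carrying \<open>y\<close> to a given point of its orbit form a coset of the stabilizer.
\<close>
lemma card_perm_act_fibre:
  assumes y: "y \<in> extensional {1..n}" and \<tau>: "\<tau> permutes {1..n}"
  shows "card {\<sigma>. \<sigma> permutes {1..n} \<and> perm_act n \<sigma> y = perm_act n \<tau> y} = stab_order n y"
  unfolding stab_order_def
proof (rule bij_betw_same_card[of "\<lambda>\<sigma>. \<sigma> \<circ> inv \<tau>"],
       rule bij_betw_byWitness[where f' = "\<lambda>\<sigma>. \<sigma> \<circ> \<tau>"])
  note inv = permutes_inv[OF \<tau>]
  show "\<forall>\<sigma>\<in>{\<sigma>. \<sigma> permutes {1..n} \<and> perm_act n \<sigma> y = perm_act n \<tau> y}. (\<sigma> \<circ> inv \<tau>) \<circ> \<tau> = \<sigma>"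
    by (simp add: comp_assoc permutes_inv_o[OF \<tau>])
  show "\<forall>\<sigma>\<in>{\<sigma>. \<sigma> permutes {1..n} \<and> perm_act n \<sigma> y = y}. (\<sigma> \<circ> \<tau>) \<circ> inv \<tau> = \<sigma>"
    by (simp add: comp_assoc permutes_inv_o[OF \<tau>])
  show "(\<lambda>\<sigma>. \<sigma> \<circ> inv \<tau>) ` {\<sigma>. \<sigma> permutes {1..n} \<and> perm_act n \<sigma> y = perm_act n \<tau> y}
          \<subseteq> {\<sigma>. \<sigma> permutes {1..n} \<and> perm_act n \<sigma> y = y}"
    using permutes_in_image[OF inv] permutes_inverses[OF \<tau>] permutes_compose[OF inv]
    by (auto simp: perm_act_eq_iff perm_act_eq_self_iff[OF y])
  show "(\<lambda>\<sigma>. \<sigma> \<circ> \<tau>) ` {\<sigma>. \<sigma> permutes {1..n} \<and> perm_act n \<sigma> y = y}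
          \<subseteq> {\<sigma>. \<sigma> permutes {1..n} \<and> perm_act n \<sigma> y = perm_act n \<tau> y}"
    using permutes_in_image[OF \<tau>] permutes_compose[OF \<tau>]
    by (auto simp: perm_act_eq_iff perm_act_eq_self_iff[OF y])
qed


section \<open>Weakly decreasing vectors as a fundamental domain\<close>

lemma D_plus_subset_cube: "D_plus n N \<subseteq> {1..n} \<rightarrow>\<^sub>E {0..<int N}"
proof
  fix k assume k: "k \<in> D_plus n N"
  have "0 \<le> k i \<and> k i < int N" if "i \<in> {1..n}" for i
    using D_plus_antimono[OF k, of 1 i] D_plus_antimono[OF k, of i n] that k
    by (auto simp: D_plus_def)
  with k show "k \<in> {1..n} \<rightarrow>\<^sub>E {0..<int N}" by (auto simp: PiE_def D_plus_def)
qed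

lemma D_plus_extensional: "k \<in> D_plus n N \<Longrightarrow> k \<in> extensional {1..n}"
  by (simp add: D_plus_def)

lemma perm_act_cube:
  assumes "y \<in> {1..n} \<rightarrow>\<^sub>E B" "\<sigma> permutes {1..n}"
  shows "perm_act n \<sigma> y \<in> {1..n} \<rightarrow>\<^sub>E B"
  using assms permutes_in_image[OF assms(2)] by (fastforce simp: perm_act_def)

text \<open>
  Rearranged vectors have the same multiset of entries, and a weakly decreasing vector is
  determined by it. Negating the entries turns weakly decreasing into sorted.
\<close>
lemma D_plus_rearrangement_unique:
  assumes k: "k \<in> D_plus n N" and k': "k' \<in> D_plus n N"
    and \<sigma>: "\<sigma> permutes {1..n}" and \<tau>: "\<tau> permutes {1..n}"
    and eq: "perm_act n \<sigma> k = perm_act n \<tau> k'"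
  shows "k = k'"
proof -
  define L where "L r = map (\<lambda>i. - r i) [1..<Suc n]" for r :: "nat \<Rightarrow> int"
  have sorted: "sorted (L r)" if r: "r \<in> D_plus n N" for r
  proof -
    have "- r (1 + i) \<le> - r (1 + j)" if "i \<le> j" "j < n" for i j
      using D_plus_antimono[OF r, of "1 + i" "1 + j"] that by simp
    then show ?thesis
      by (auto simp: L_def sorted_iff_nth_mono simp del: upt_Suc)
  qed
  have mset: "mset (L r) = image_mset (\<lambda>i. - r (\<pi> i)) (mset_set {1..n})"
    if \<pi>: "\<pi> permutes {1..n}" for r \<pi>
  proof -
    have "mset (L r) = image_mset (\<lambda>i. - r i) (mset_set {1..n})"
      by (simp add: L_def atLeastLessThanSuc_atLeastAtMost del: upt_Suc)
    also have "mset_set {1..n} = image_mset \<pi> (mset_set {1..n})"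
      by (simp only: image_mset_mset_set[OF permutes_inj_on[OF \<pi>]] permutes_image[OF \<pi>])
    finally show ?thesis by (simp add: image_mset.compositionality comp_def)
  qed
  have "mset (L k) = mset (L k')"
    unfolding mset[OF \<sigma>, of k] mset[OF \<tau>, of k']
    using eq by (intro image_mset_cong) (simp add: perm_act_eq_iff)
  then have "L k = L k'"
    using properties_for_sort sorted[OF k] sorted[OF k'] by metis
  then have "k i = k' i" if "i \<in> {1..n}" for i
    using that unfolding L_def map_eq_conv by (auto simp del: upt_Suc)
  then show ?thesis
    using D_plus_extensional[OF k] D_plus_extensional[OF k'] by (intro extensionalityI)
qed

lemma cube_sortable:
  assumes n: "n \<ge> 1" and y: "y \<in> {1..n} \<rightarrow>\<^sub>E {0..<int N}"
  obtains k \<sigma> where "k \<in> D_plus n N" "\<sigma> permutes {1..n}" "y = perm_act n \<sigma> k"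
proof -
  define xs where "xs = sort (map (\<lambda>i. - y i) [1..<Suc n])"
  have len: "length xs = n" by (simp add: xs_def)
  define k where "k = (\<lambda>i\<in>{1..n}. - xs ! (i - 1))"
  have mset_xs: "mset xs = image_mset (\<lambda>i. - y i) (mset_set {1..n})"
    by (simp add: xs_def atLeastLessThanSuc_atLeastAtMost del: upt_Suc)
  have "image_mset k (mset_set {1..n}) = mset (map k [1..<Suc n])"
    by (simp add: atLeastLessThanSuc_atLeastAtMost del: upt_Suc)
  also have "map k [1..<Suc n] = map uminus xs"
    by (rule nth_equalityI) (auto simp: len k_def simp del: upt_Suc)
  finally have "image_mset y (mset_set {1..n}) = image_mset k (mset_set {1..n})"
    by (simp add: mset_xs image_mset.compositionality comp_def)
  then obtain \<sigma> where \<sigma>: "\<sigma> permutes {1..n}" "\<forall>i\<in>{1..n}. y i = k (\<sigma> i)"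
    using image_mset_eq_implies_permutes[of "{1..n}" y k] by auto
  have eq: "y = perm_act n \<sigma> k"
    using \<sigma>(2) y by (auto simp: perm_act_def fun_eq_iff PiE_def extensional_def)
  have "set xs \<subseteq> {- int N <.. 0}"
    using y by (force simp: xs_def PiE_def)
  then have bd: "- int N < xs ! i \<and> xs ! i \<le> 0" if "i < n" for i
    using that len nth_mem[of i xs] by (simp add: subset_iff)
  have "sorted xs" by (simp add: xs_def)
  then have mono: "xs ! i \<le> xs ! j" if "i \<le> j" "j < n" for i j
    using that len by (simp add: sorted_iff_nth_mono)
  have "k \<in> D_plus n N"
    using n bd[of 0] bd[of "n - 1"] mono by (auto simp: D_plus_def k_def)
  with \<sigma>(1) eq show thesis by (intro that)
qed

text \<open>
  Count the pairs \<open>(\<sigma>, r)\<close> by \<open>y = r \<circ> \<sigma>\<close>: exactly one weakly decreasing \<open>r\<close> occurs for a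
  given point \<open>y\<close> of the cube, together with \<open>H\<^sub>r\<close> permutations, whose total weight is therefore \<open>1\<close>.
\<close>
lemma sum_cube_eq_sum_D_plus:
  fixes g :: "(nat \<Rightarrow> int) \<Rightarrow> real"
  assumes n: "n \<ge> 1"
    and sym: "\<And>y \<sigma>. y \<in> D_plus n N \<Longrightarrow> \<sigma> permutes {1..n} \<Longrightarrow> g (perm_act n \<sigma> y) = g y"
  shows "(\<Sum>y\<in>{1..n} \<rightarrow>\<^sub>E {0..<int N}. g y)
           = fact n * (\<Sum>r\<in>D_plus n N. inverse (real (stab_order n r)) * g r)"
proof -
  let ?S = "{\<sigma>. \<sigma> permutes {1..n}}" and ?D = "D_plus n N" and ?C = "{1..n} \<rightarrow>\<^sub>E {0..<int N}"
  define w where "w r = inverse (real (stab_order n r))" for r :: "nat \<Rightarrow> int"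
  have fin: "finite ?S" "finite ?D" "finite ?C"
    using finite_D_plus[OF n] by (auto intro: finite_permutations finite_PiE)
  have weight: "(\<Sum>p\<in>{p \<in> ?S \<times> ?D. perm_act n (fst p) (snd p) = y}. w (snd p)) = 1"
    if y: "y \<in> ?C" for y
  proof -
    obtain k \<tau> where k: "k \<in> ?D" and \<tau>: "\<tau> permutes {1..n}" and y: "y = perm_act n \<tau> k"
      using cube_sortable[OF n y] by blast
    have "(\<sigma> \<in> ?S \<and> r \<in> ?D) \<and> perm_act n \<sigma> r = y
            \<longleftrightarrow> (\<sigma> \<in> ?S \<and> perm_act n \<sigma> k = perm_act n \<tau> k) \<and> r = k" for \<sigma> r
      unfolding y using D_plus_rearrangement_unique[OF _ k _ \<tau>] k by blast
    then have "{p \<in> ?S \<times> ?D. perm_act n (fst p) (snd p) = y}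
            = {\<sigma> \<in> ?S. perm_act n \<sigma> k = perm_act n \<tau> k} \<times> {k}"
      by (simp add: set_eq_iff)
    then have "(\<Sum>p\<in>{p \<in> ?S \<times> ?D. perm_act n (fst p) (snd p) = y}. w (snd p))
                 = (\<Sum>p\<in>{\<sigma> \<in> ?S. perm_act n \<sigma> k = perm_act n \<tau> k} \<times> {k}. w k)"
      by (intro sum.cong) auto
    also have "\<dots> = real (stab_order n k) * w k"
      using card_perm_act_fibre[OF D_plus_extensional[OF k] \<tau>] by (simp add: card_cartesian_product)
    finally have "(\<Sum>p\<in>{p \<in> ?S \<times> ?D. perm_act n (fst p) (snd p) = y}. w (snd p))
                    = real (stab_order n k) * w k" .
    then show ?thesis
      using stab_order_pos[OF D_plus_extensional[OF k]] by (simp add: w_def)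
  qed
  have "(\<Sum>y\<in>?C. g y)
          = (\<Sum>y\<in>?C. \<Sum>p\<in>{p \<in> ?S \<times> ?D. perm_act n (fst p) (snd p) = y}. w (snd p) * g y)"
    by (intro sum.cong refl) (simp only: sum_distrib_right[symmetric] weight mult_1)
  also have "\<dots> = (\<Sum>y\<in>?C. \<Sum>p\<in>{p \<in> ?S \<times> ?D. perm_act n (fst p) (snd p) = y}. w (snd p) * g (snd p))"
    by (intro sum.cong refl) (auto simp: sym)
  also have "\<dots> = (\<Sum>p\<in>?S \<times> ?D. w (snd p) * g (snd p))"
  proof (intro sum.group)
    show "(\<lambda>p. perm_act n (fst p) (snd p)) ` (?S \<times> ?D) \<subseteq> ?C"
    proof (rule image_subsetI)
      fix p assume "p \<in> ?S \<times> ?D"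
      then have "snd p \<in> ?C" "fst p permutes {1..n}"
        using subsetD[OF D_plus_subset_cube] by (simp_all only: mem_Times_iff mem_Collect_eq)
      then show "perm_act n (fst p) (snd p) \<in> ?C" by (rule perm_act_cube)
    qed
  qed (use fin in auto)
  also have "\<dots> = (\<Sum>\<sigma>\<in>?S. \<Sum>r\<in>?D. w r * g r)"
    by (simp only: sum.cartesian_product case_prod_unfold)
  also have "\<dots> = fact n * (\<Sum>r\<in>?D. w r * g r)"
    by (simp add: card_permutations)
  finally show ?thesis by (simp add: w_def)
qed


section \<open>Symmetrized kernels\<close>

definition sym_kernel ::
    "nat \<Rightarrow> ('a \<Rightarrow> 'b \<Rightarrow> real) \<Rightarrow> (nat \<Rightarrow> 'a) \<Rightarrow> (nat \<Rightarrow> 'b) \<Rightarrow> real" where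
  "sym_kernel n \<kappa> k x = (\<Sum>\<sigma> | \<sigma> permutes {1..n}. \<Prod>i=1..n. \<kappa> (k (\<sigma> i)) (x i))"

lemma sym_kernel_perm_act:
  assumes \<tau>: "\<tau> permutes {1..n}"
  shows "sym_kernel n \<kappa> k (perm_act n \<tau> x) = sym_kernel n \<kappa> k x"
proof -
  have "sym_kernel n \<kappa> k (perm_act n \<tau> x)
          = (\<Sum>\<sigma> | \<sigma> permutes {1..n}. \<Prod>i=1..n. \<kappa> (k ((\<sigma> \<circ> \<tau>) i)) (x (\<tau> i)))"
    unfolding sym_kernel_def
    by (subst sum_permutations_compose_right[OF \<tau>]) (simp add: perm_act_def)
  also have "\<dots> = sym_kernel n \<kappa> k x"
    unfolding sym_kernel_def by (subst (2) prod.permute[OF \<tau>]) (simp add: comp_def)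
  finally show ?thesis .
qed

lemma sym_kernel_swap: "sym_kernel n \<kappa> k x = sym_kernel n (\<lambda>a b. \<kappa> b a) x k"
proof -
  have "(\<Prod>i=1..n. \<kappa> (k (inv \<sigma> i)) (x i)) = (\<Prod>i=1..n. \<kappa> (k i) (x (\<sigma> i)))"
    if "\<sigma> permutes {1..n}" for \<sigma>
    using prod.permute[OF that, of "\<lambda>i. \<kappa> (k (inv \<sigma> i)) (x i)"]
    by (simp add: comp_def permutes_inverses[OF that])
  then show ?thesis
    unfolding sym_kernel_def by (subst sum_permutations_inverse) simp
qed

text \<open>
  Over the cube the sum of a product of two tensor products factorizes, so that each pair
  \<open>(\<sigma>, \<tau>)\<close> contributes \<open>c\<^sup>n\<close> if \<open>k \<circ> \<sigma> = k' \<circ> \<tau>\<close> and \<open>0\<close> otherwise.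
\<close>
lemma sym_kernel_orthogonal:
  fixes \<kappa> :: "int \<Rightarrow> int \<Rightarrow> real"
  assumes n: "n \<ge> 1"
    and orth: "\<And>j j'. j \<in> {0..<int N} \<Longrightarrow> j' \<in> {0..<int N} \<Longrightarrow>
                 (\<Sum>r\<in>{0..<int N}. \<kappa> j r * \<kappa> j' r) = (if j = j' then c else 0)"
    and k: "k \<in> D_plus n N" and k': "k' \<in> D_plus n N"
  shows "(\<Sum>r\<in>D_plus n N. inverse (real (stab_order n r)) * sym_kernel n \<kappa> k r * sym_kernel n \<kappa> k' r)
           = real (stab_order n k) * c ^ n * (if k = k' then 1 else 0)"
proof -
  let ?S = "{\<sigma>. \<sigma> permutes {1..n}}" and ?C = "{1..n} \<rightarrow>\<^sub>E {0..<int N}"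
  have finS: "finite ?S" by (simp add: finite_permutations)
  have pair: "(\<Sum>y\<in>?C. \<Prod>i=1..n. \<kappa> (k (\<sigma> i)) (y i) * \<kappa> (k' (\<tau> i)) (y i))
          = (if perm_act n \<sigma> k = perm_act n \<tau> k' then c ^ n else 0)"
    if \<sigma>: "\<sigma> \<in> ?S" and \<tau>: "\<tau> \<in> ?S" for \<sigma> \<tau>
  proof -
    have range: "k (\<sigma> i) \<in> {0..<int N}" "k' (\<tau> i) \<in> {0..<int N}" if "i \<in> {1..n}" for i
      using that k k' D_plus_subset_cube[of n N] \<sigma> \<tau>
        permutes_in_image[of \<sigma> "{1..n}" i] permutes_in_image[of \<tau> "{1..n}" i]
      by (blast dest: PiE_mem)+
    have "(\<Sum>y\<in>?C. \<Prod>i=1..n. \<kappa> (k (\<sigma> i)) (y i) * \<kappa> (k' (\<tau> i)) (y i))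
            = (\<Prod>i=1..n. \<Sum>r\<in>{0..<int N}. \<kappa> (k (\<sigma> i)) r * \<kappa> (k' (\<tau> i)) r)"
      by (rule prod_sum_PiE[symmetric]) auto
    also have "\<dots> = (\<Prod>i=1..n. if k (\<sigma> i) = k' (\<tau> i) then c else 0)"
      by (intro prod.cong refl orth range)
    also have "\<dots> = (if \<forall>i\<in>{1..n}. k (\<sigma> i) = k' (\<tau> i) then c ^ n else 0)"
    proof (cases "\<forall>i\<in>{1..n}. k (\<sigma> i) = k' (\<tau> i)")
      case False
      then have "(\<Prod>i=1..n. if k (\<sigma> i) = k' (\<tau> i) then c else 0) = 0"
        by (intro prod_zero) auto
      with False show ?thesis by simp
    qed simp
    finally show ?thesis by (simp add: perm_act_eq_iff)
  qed
  have count: "(\<Sum>\<sigma>\<in>?S. if perm_act n \<sigma> k = perm_act n \<tau> k' then c ^ n else 0)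
          = (if k = k' then real (stab_order n k) * c ^ n else 0)" if \<tau>: "\<tau> \<in> ?S" for \<tau>
  proof (cases "k = k'")
    case True
    then show ?thesis
      using card_perm_act_fibre[OF D_plus_extensional[OF k], of \<tau>] \<tau> finS
      by (simp add: sum.If_cases Int_def)
  next
    case False
    then have "perm_act n \<sigma> k \<noteq> perm_act n \<tau> k'" if "\<sigma> \<in> ?S" for \<sigma>
      using D_plus_rearrangement_unique[OF k k'] \<tau> that by blast
    with False show ?thesis by simp
  qed
  have "fact n * (\<Sum>r\<in>D_plus n N. inverse (real (stab_order n r)) * (sym_kernel n \<kappa> k r * sym_kernel n \<kappa> k' r))
          = (\<Sum>y\<in>?C. sym_kernel n \<kappa> k y * sym_kernel n \<kappa> k' y)"
    by (rule sum_cube_eq_sum_D_plus[OF n, symmetric]) (simp add: sym_kernel_perm_act)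
  also have "\<dots> = (\<Sum>y\<in>?C. \<Sum>\<sigma>\<in>?S. \<Sum>\<tau>\<in>?S. \<Prod>i=1..n. \<kappa> (k (\<sigma> i)) (y i) * \<kappa> (k' (\<tau> i)) (y i))"
    by (simp add: sym_kernel_def sum_product prod.distrib)
  also have "\<dots> = (\<Sum>\<sigma>\<in>?S. \<Sum>y\<in>?C. \<Sum>\<tau>\<in>?S. \<Prod>i=1..n. \<kappa> (k (\<sigma> i)) (y i) * \<kappa> (k' (\<tau> i)) (y i))"
    by (rule sum.swap)
  also have "\<dots> = (\<Sum>\<sigma>\<in>?S. \<Sum>\<tau>\<in>?S. \<Sum>y\<in>?C. \<Prod>i=1..n. \<kappa> (k (\<sigma> i)) (y i) * \<kappa> (k' (\<tau> i)) (y i))"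
    by (intro sum.cong refl sum.swap)
  also have "\<dots> = (\<Sum>\<sigma>\<in>?S. \<Sum>\<tau>\<in>?S. if perm_act n \<sigma> k = perm_act n \<tau> k' then c ^ n else 0)"
    by (intro sum.cong refl pair)
  also have "\<dots> = (\<Sum>\<tau>\<in>?S. \<Sum>\<sigma>\<in>?S. if perm_act n \<sigma> k = perm_act n \<tau> k' then c ^ n else 0)"
    by (rule sum.swap)
  also have "\<dots> = (\<Sum>\<tau>\<in>?S. if k = k' then real (stab_order n k) * c ^ n else 0)"
    by (intro sum.cong refl count)
  also have "\<dots> = fact n * (real (stab_order n k) * c ^ n * (if k = k' then 1 else 0))"
    by (simp add: card_permutations)
  finally show ?thesis by (simp add: mult.assoc)
qed

text \<open>
  For a symmetric kernel the orthogonality relation reads the same with indices and grid points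
  interchanged, and so states completeness.
\<close>
lemma sym_kernel_expansion:
  fixes \<kappa> :: "int \<Rightarrow> int \<Rightarrow> real" and f :: "(nat \<Rightarrow> int) \<Rightarrow> real"
  assumes n: "n \<ge> 1"
    and orth: "\<And>j j'. j \<in> {0..<int N} \<Longrightarrow> j' \<in> {0..<int N} \<Longrightarrow>
                 (\<Sum>r\<in>{0..<int N}. \<kappa> j r * \<kappa> j' r) = (if j = j' then c else 0)"
    and c: "c \<noteq> 0" and sym: "\<And>a b. \<kappa> a b = \<kappa> b a" and r: "r \<in> D_plus n N"
  shows "(\<Sum>k\<in>D_plus n N. 1 / real (stab_order n k) * (1 / c) ^ n *
            (\<Sum>q\<in>D_plus n N. inverse (real (stab_order n q)) * f q * sym_kernel n \<kappa> k q)
            * sym_kernel n \<kappa> k r) = f r"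
proof -
  let ?D = "D_plus n N" and ?h = "\<lambda>k :: nat \<Rightarrow> int. inverse (real (stab_order n k))"
  have swap: "sym_kernel n \<kappa> a b = sym_kernel n \<kappa> b a" for a b
    using sym_kernel_swap[of n \<kappa> a b] sym by presburger
  have "(\<Sum>k\<in>?D. 1 / real (stab_order n k) * (1 / c) ^ n *
            (\<Sum>q\<in>?D. ?h q * f q * sym_kernel n \<kappa> k q) * sym_kernel n \<kappa> k r)
        = (\<Sum>k\<in>?D. \<Sum>q\<in>?D. (1 / c) ^ n * ?h q * f q *
              (?h k * sym_kernel n \<kappa> q k * sym_kernel n \<kappa> r k))"
    unfolding sum_distrib_left sum_distrib_right
  proof (intro sum.cong refl)
    fix k q
    show "1 / real (stab_order n k) * (1 / c) ^ n * (?h q * f q * sym_kernel n \<kappa> k q) * sym_kernel n \<kappa> k r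
            = (1 / c) ^ n * ?h q * f q * (?h k * sym_kernel n \<kappa> q k * sym_kernel n \<kappa> r k)"
      unfolding swap[of k q] swap[of k r] by (simp add: divide_inverse mult_ac)
  qed
  also have "\<dots> = (\<Sum>q\<in>?D. \<Sum>k\<in>?D. (1 / c) ^ n * ?h q * f q *
              (?h k * sym_kernel n \<kappa> q k * sym_kernel n \<kappa> r k))"
    by (rule sum.swap)
  also have "\<dots> = (\<Sum>q\<in>?D. (1 / c) ^ n * ?h q * f q *
              (real (stab_order n q) * c ^ n * (if q = r then 1 else 0)))"
    by (intro sum.cong refl)
      (simp only: sum_distrib_left[symmetric] sym_kernel_orthogonal[OF n orth _ r])
  also have "\<dots> = (\<Sum>q\<in>?D. if q = r then f q else 0)"
    using stab_order_pos[OF D_plus_extensional[OF r]] c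
    by (intro sum.cong refl) (auto simp: power_one_over)
  also have "\<dots> = f r"
    using r finite_D_plus[OF n] by simp
  finally show ?thesis .
qed


section \<open>The one-dimensional transform\<close>

definition cos_kernel :: "nat \<Rightarrow> int \<Rightarrow> int \<Rightarrow> real" where
  "cos_kernel N j r =
     cos (pi * (of_int j + 1/2) * (2 * (of_int r + 1/2) / (2 * real N + 1)))"

lemma sin_times_sum_cos_odd: "2 * sin a * (\<Sum>r<N. cos ((2 * real r + 1) * a)) = sin (2 * real N * a)"
proof (induction N)
  case (Suc N)
  have "2 * sin a * cos ((2 * real N + 1) * a) = sin (2 * real (Suc N) * a) - sin (2 * real N * a)"
  proof -
    have "2 * real (Suc N) * a = (2 * real N + 1) * a + a" "2 * real N * a = (2 * real N + 1) * a - a"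
      by (simp_all add: algebra_simps)
    then show ?thesis by (simp only: sin_add sin_diff) simp
  qed
  with Suc show ?case by (simp add: distrib_left)
qed simp

text \<open>
  For \<open>a = \<pi>m/(2N+1)\<close> the closed form of the sum is \<open>sin (\<pi>m - a) / (2 sin a)\<close>, which is
  \<open>- cos (\<pi>m) / 2\<close>. The bounds on \<open>m\<close> ensure \<open>sin a \<noteq> 0\<close>.
\<close>
lemma sum_cos_odd:
  fixes m :: int
  assumes "m \<noteq> 0" "\<bar>m\<bar> < 2 * int N + 1"
  shows "(\<Sum>r<N. cos ((2 * real r + 1) * (pi * of_int m / (2 * real N + 1))))
           = (if even m then -1/2 else 1/2)"
proof -
  define a where "a = pi * of_int m / (2 * real N + 1)"
  have "sin a \<noteq> 0"
  proof
    assume "sin a = 0"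
    then obtain i :: int where "a = of_int i * pi"
      using sin_zero_iff_int2 by auto
    then have "pi * of_int m = pi * (of_int i * (2 * real N + 1))"
      by (simp add: a_def divide_eq_eq mult_ac)
    then have "of_int m = (of_int i * (2 * real N + 1) :: real)"
      by (simp only: mult_cancel_left pi_neq_zero simp_thms)
    then have "m = i * (2 * int N + 1)"
      by (metis (mono_tags, opaque_lifting) of_int_1 of_int_add of_int_eq_iff of_int_mult
            of_int_numeral of_int_of_nat_eq)
    then have "2 * int N + 1 dvd m" by simp
    with assms show False
      by (meson dvd_imp_le_int not_less abs_ge_self order.trans)
  qed
  moreover have "2 * real N * a = pi * of_int m - a"
    by (simp add: a_def field_simps)
  then have "sin (2 * real N * a) = - cos (pi * of_int m) * sin a"
    by (simp add: sin_diff)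
  then have "sin a * (2 * (\<Sum>r<N. cos ((2 * real r + 1) * a))) = sin a * - cos (pi * of_int m)"
    unfolding sin_times_sum_cos_odd[of a N, symmetric] by algebra
  ultimately have "2 * (\<Sum>r<N. cos ((2 * real r + 1) * a)) = - cos (pi * of_int m)"
    by (simp only: mult_cancel_left simp_thms)
  then have "(\<Sum>r<N. cos ((2 * real r + 1) * a)) = - cos (pi * of_int m) / 2"
    by linarith
  moreover have "cos (pi * of_int m) = (if even m then 1 else -1)"
    by (auto elim!: evenE oddE simp: distrib_left cos_add mult.commute)
  ultimately show ?thesis
    unfolding a_def[symmetric] by simp
qed

text \<open>
  By the product-to-sum formula only sums of the previous kind with \<open>m = j + j' + 1\<close> and
  \<open>m = j - j'\<close> occur. These have opposite parity, so the two sums cancel unless \<open>j = j'\<close>.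
\<close>
lemma cos_kernel_orthogonal:
  assumes "j \<in> {0..<int N}" "j' \<in> {0..<int N}"
  shows "(\<Sum>r\<in>{0..<int N}. cos_kernel N j r * cos_kernel N j' r)
           = (if j = j' then (2 * real N + 1) / 4 else 0)"
proof -
  let ?C = "\<lambda>m :: int. \<Sum>r<N. cos ((2 * real r + 1) * (pi * of_int m / (2 * real N + 1)))"
  have prod: "cos_kernel N j (int r) * cos_kernel N j' (int r)
      = (cos ((2 * real r + 1) * (pi * of_int (j - j') / (2 * real N + 1)))
         + cos ((2 * real r + 1) * (pi * of_int (j + j' + 1) / (2 * real N + 1)))) / 2" for r
  proof -
    define d where "d = 2 * real N + 1"
    have "d \<noteq> 0" by (simp add: d_def)
    then show ?thesis
      unfolding cos_kernel_def cos_times_cos d_def[symmetric]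
      by (intro arg_cong2[where f = "(/)"] arg_cong2[where f = "(+)"] arg_cong[where f = cos] refl)
        (simp_all add: field_simps)
  qed
  have "{0..<int N} = int ` {..<N}"
    by (simp add: lessThan_atLeast0 image_int_atLeastLessThan)
  then have "(\<Sum>r\<in>{0..<int N}. cos_kernel N j r * cos_kernel N j' r)
      = (\<Sum>r<N. cos_kernel N j (int r) * cos_kernel N j' (int r))"
    by (simp add: sum.reindex)
  also have "\<dots> = (?C (j - j') + ?C (j + j' + 1)) / 2"
    unfolding prod by (simp add: sum.distrib sum_divide_distrib[symmetric])
  also have "?C (j + j' + 1) = (if even (j + j' + 1) then -1/2 else 1/2)"
    using assms by (intro sum_cos_odd) auto
  also have "?C (j - j') = (if j = j' then real N else if even (j - j') then -1/2 else 1/2)"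
  proof (cases "j = j'")
    case False
    then have "?C (j - j') = (if even (j - j') then -1/2 else 1/2)"
      using assms by (intro sum_cos_odd) auto
    with False show ?thesis by simp
  qed simp
  finally show ?thesis
    by (cases "j = j'"; cases "even j"; cases "even j'"; simp)
qed

lemma cos_kernel_sym: "cos_kernel N j r = cos_kernel N r j"
  unfolding cos_kernel_def by (intro arg_cong[where f = cos]) (simp add: algebra_simps)


section \<open>The symmetric cosine transform\<close>

definition grid_point :: "nat \<Rightarrow> nat \<Rightarrow> (nat \<Rightarrow> int) \<Rightarrow> (nat \<Rightarrow> real)" where
  "grid_point n N r = (\<lambda>i\<in>{1..n}. 2 * (real_of_int (r i) + 1/2) / (2 * real N + 1))"

lemma F_VIII_plus_eq: "F_VIII_plus n N = grid_point n N ` D_plus n N"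
  by (simp add: F_VIII_plus_def grid_point_def)

lemma grid_value_eq_iff:
  "2 * (real_of_int a + 1/2) / (2 * real N + 1) = 2 * (real_of_int b + 1/2) / (2 * real N + 1)
     \<longleftrightarrow> a = b"
  by (simp add: divide_cancel_right)

lemma inj_on_grid_point: "inj_on (grid_point n N) (D_plus n N)"
proof (rule inj_onI)
  fix k k' assume k: "k \<in> D_plus n N" "k' \<in> D_plus n N" and eq: "grid_point n N k = grid_point n N k'"
  have "k i = k' i" if "i \<in> {1..n}" for i
    using fun_cong[OF eq, of i] that by (simp only: grid_point_def restrict_apply' grid_value_eq_iff)
  then show "k = k'"
    using k D_plus_extensional by (metis extensionalityI)
qed

lemma stab_order_grid_point:
  assumes "r \<in> extensional {1..n}"
  shows "stab_order n (grid_point n N r) = stab_order n r"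
proof -
  have "perm_act n \<sigma> (grid_point n N r) = grid_point n N r \<longleftrightarrow> perm_act n \<sigma> r = r"
    if "\<sigma> permutes {1..n}" for \<sigma>
  proof -
    have "grid_point n N r \<in> extensional {1..n}" by (simp add: grid_point_def)
    then show ?thesis
      using permutes_in_image[OF that]
      by (simp only: perm_act_eq_self_iff assms) (simp add: grid_point_def grid_value_eq_iff)
  qed
  then show ?thesis
    unfolding stab_order_def by (intro arg_cong[where f = card]) auto
qed

lemma cos_plus_grid_point:
  "cos_plus n (shift_rho n k) (grid_point n N r) = sym_kernel n (cos_kernel N) k r"
  unfolding cos_plus_def sym_kernel_def
proof (intro sum.cong prod.cong refl)
  fix \<sigma> i assume "\<sigma> \<in> {\<sigma>. \<sigma> permutes {1..n}}" "i \<in> {1..n}"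
  then show "cos (pi * shift_rho n k (\<sigma> i) * grid_point n N r i) = cos_kernel N (k (\<sigma> i)) (r i)"
    using permutes_in_image[of \<sigma> "{1..n}" i]
    by (simp add: shift_rho_def rho_def grid_point_def cos_kernel_def)
qed

lemma sum_F_VIII_plus:
  "(\<Sum>s\<in>F_VIII_plus n N. inverse (real (stab_order n s)) * h s)
     = (\<Sum>r\<in>D_plus n N. inverse (real (stab_order n r)) * h (grid_point n N r))"
  unfolding F_VIII_plus_eq
  unfolding sum.reindex[OF inj_on_grid_point]
  by (intro sum.cong refl) (simp add: stab_order_grid_point[OF D_plus_extensional])

theorem mainTheorem8:
  fixes n N :: nat
  assumes "n \<ge> 1" and "N \<ge> 1"
  shows "(\<forall>k\<in>D_plus n N. \<forall>k'\<in>D_plus n N.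
            (\<Sum>s\<in>F_VIII_plus n N. inverse (real (stab_order n s)) *
               cos_plus n (shift_rho n k) s * cos_plus n (shift_rho n k') s)
            = real (stab_order n k) * ((2 * real N + 1) / 4) ^ n * (if k = k' then 1 else 0))
       \<and> (\<forall>f :: (nat \<Rightarrow> real) \<Rightarrow> real. \<forall>s\<in>F_VIII_plus n N.
            f s = (\<Sum>k\<in>D_plus n N. coeff_VIII_plus n N f k * cos_plus n (shift_rho n k) s))"
proof (intro conjI ballI allI)
  fix k k' assume "k \<in> D_plus n N" "k' \<in> D_plus n N"
  from sym_kernel_orthogonal[OF assms(1) cos_kernel_orthogonal this]
  show "(\<Sum>s\<in>F_VIII_plus n N. inverse (real (stab_order n s)) *
           cos_plus n (shift_rho n k) s * cos_plus n (shift_rho n k') s)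
        = real (stab_order n k) * ((2 * real N + 1) / 4) ^ n * (if k = k' then 1 else 0)"
    by (simp only: mult.assoc sum_F_VIII_plus cos_plus_grid_point)
next
  fix f :: "(nat \<Rightarrow> real) \<Rightarrow> real" and s assume "s \<in> F_VIII_plus n N"
  then obtain r where r: "r \<in> D_plus n N" and s: "s = grid_point n N r"
    by (auto simp: F_VIII_plus_eq)
  have "coeff_VIII_plus n N f k = 1 / real (stab_order n k) * (1 / ((2 * real N + 1) / 4)) ^ n *
      (\<Sum>q\<in>D_plus n N. inverse (real (stab_order n q)) * f (grid_point n N q)
          * sym_kernel n (cos_kernel N) k q)" for k
    unfolding coeff_VIII_plus_def mult.assoc sum_F_VIII_plus cos_plus_grid_point by simp
  then show "f s = (\<Sum>k\<in>D_plus n N. coeff_VIII_plus n N f k * cos_plus n (shift_rho n k) s)"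
    using sym_kernel_expansion[OF assms(1) cos_kernel_orthogonal _ cos_kernel_sym r,
        where f = "\<lambda>q. f (grid_point n N q)"]
    by (simp add: s cos_plus_grid_point)
qed

end
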